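(* Let $(A,\cdot,\varepsilon,\alpha,\beta)$ be a regular BiHom-associative color algebra. Define an even bilinear bracket on $A$ by $$[x,y]=x\cdot y-\varepsilon(x,y)\,\alpha^{-1}\beta(y)\cdot\alpha\beta^{-1}(x)$$ for all homogeneous $x,y\in A$. Then $(A,\cdot,[-,-],\varepsilon,\alpha,\beta)$ is a regular BiHom-Poisson color algebra.
   Context: $\mathbb{K}$ is a field of characteristic different from 2 and $G$ is an abelian group (written additively). A skew-symmetric bicharacter on $G$ is a map $\varepsilon:G\times G\to\mathbb{K}^*$ with $\varepsilon(g,g')\varepsilon(g',g)=1$, $\varepsilon(g,g'+g'')=\varepsilon(g,g')\varepsilon(g,g'')$, $\varepsilon(g+g',g'')=\varepsilon(g,g'')\varepsilon(g',g'')$; $\varepsilon$ denotes such a bicharacter. For homogeneous elements $x,y$ of degrees $g,g'$ one writes $\varepsilon(x,y)=\varepsilon(g,g')$ (and similarly $\varepsilon(x,y+z)=\varepsilon(\deg x,\deg y+\deg z)$). A linear map is even if it preserves degrees; a bilinear map $\mu$ is even if $\mu(V_g,V_{g'})\subseteq V_{g+g'}$. A BiHom-associative color algebra $(A,\cdot,\varepsilon,\alpha,\beta)$ is a $G$-graded $\mathbb{K}$-vector space $A$ with an even bilinear product $\cdot$ and even linear maps $\alpha,\beta:A\to A$ such that $\alpha\beta=\beta\alpha$, $\alpha(x\cdot y)=\alpha(x)\cdot\alpha(y)$, $\beta(x\cdot y)=\beta(x)\cdot\beta(y)$, and $\alpha(x)\cdot(y\cdot z)=(x\cdot y)\cdot\beta(z)$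 for all homogeneous $x,y,z$. It is regular if $\alpha,\beta$ are automorphisms (bijective). A BiHom-Poisson color algebra $(P,\cdot,[-,-],\varepsilon,\alpha,\beta)$ is a BiHom-associative color algebra $(P,\cdot,\varepsilon,\alpha,\beta)$ together with an even bilinear bracket such that, for all homogeneous $x,y,z$: - $\alpha([x,y])=[\alpha(x),\alpha(y)]$ and $\beta([x,y])=[\beta(x),\beta(y)]$; - $[\beta(x),\alpha(y)]=-\varepsilon(x,y)[\beta(y),\alpha(x)]$; - $\oint_{x,y,z}\varepsilon(z,x)[\beta^2(x),[\beta(y),\alpha(z)]]=0$ (cyclic sum over $x,y,z$); - $[\alpha\beta(x),y\cdot z]=[\beta(x),y]\cdot\beta(z)+\varepsilon(x,y)\,\beta(y)\cdot[\alpha(x),z]$. It is regular if $\alpha,\beta$ are automorphisms. *)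

theory Defs
  imports Complex_Main
begin

locale skew_bicharacter =
  fixes \<epsilon> :: "'g::ab_group_add \<Rightarrow> 'g \<Rightarrow> 'k::field"
  assumes nonzero: "\<epsilon> g h \<noteq> 0"
    and skew: "\<epsilon> g h * \<epsilon> h g = 1"
    and add_right: "\<epsilon> g (h + h') = \<epsilon> g h * \<epsilon> g h'"
    and add_left: "\<epsilon> (g + g') h = \<epsilon> g h * \<epsilon> g' h"

(* The whole type is the internal direct sum of the subspaces V g: every vector is, in exactly
   one way, a sum of a finitely supported family of components f g in V g. *)
locale graded_vector_space = vector_space scale
  for scale :: "'k::field \<Rightarrow> 'a::ab_group_add \<Rightarrow> 'a"  (infixr \<open>*s\<close> 75) +
  fixes V :: "'g::ab_group_add \<Rightarrow> 'a set"
  assumes subspace_component: "subspace (V g)"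
    and unique_decomposition:
      "\<exists>!f. (\<forall>g. f g \<in> V g) \<and> finite {g. f g \<noteq> 0} \<and> x = (\<Sum>g | f g \<noteq> 0. f g)"

definition even_linear ::
    "('k::field \<Rightarrow> 'a::ab_group_add \<Rightarrow> 'a) \<Rightarrow> ('g::ab_group_add \<Rightarrow> 'a set) \<Rightarrow> ('a \<Rightarrow> 'a) \<Rightarrow> bool"
  where "even_linear scale V f \<longleftrightarrow>
    Vector_Spaces.linear scale scale f \<and> (\<forall>g. \<forall>x\<in>V g. f x \<in> V g)"

definition even_bilinear ::
    "('k::field \<Rightarrow> 'a::ab_group_add \<Rightarrow> 'a) \<Rightarrow> ('g::ab_group_add \<Rightarrow> 'a set) \<Rightarrow> ('a \<Rightarrow> 'a \<Rightarrow> 'a) \<Rightarrow> bool"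
  where "even_bilinear scale V m \<longleftrightarrow>
    (\<forall>x. Vector_Spaces.linear scale scale (\<lambda>y. m x y)) \<and>
    (\<forall>y. Vector_Spaces.linear scale scale (\<lambda>x. m x y)) \<and>
    (\<forall>g h. \<forall>x\<in>V g. \<forall>y\<in>V h. m x y \<in> V (g + h))"

(* Identities for homogeneous elements x, y, z are stated for all degrees g, h, k and all x in V g,
   y in V h, z in V k; so epsilon (x, y) is epsilon g h. The zero vector lies in every V g, where
   these identities hold trivially. *)
locale bihom_assoc_color_algebra =
  graded_vector_space scale V + skew_bicharacter \<epsilon>
  for scale :: "'k::field \<Rightarrow> 'a::ab_group_add \<Rightarrow> 'a"  (infixr \<open>*s\<close> 75)
    and V :: "'g::ab_group_add \<Rightarrow> 'a set"
    and \<epsilon> :: "'g \<Rightarrow> 'g \<Rightarrow> 'k" +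
  fixes mult :: "'a \<Rightarrow> 'a \<Rightarrow> 'a"  (infixl \<open>\<cdot>\<close> 70)
    and \<alpha> \<beta> :: "'a \<Rightarrow> 'a"
  assumes mult_even_bilinear: "even_bilinear scale V mult"
    and \<alpha>_even_linear: "even_linear scale V \<alpha>"
    and \<beta>_even_linear: "even_linear scale V \<beta>"
    and \<alpha>_\<beta>_commute: "\<alpha> \<circ> \<beta> = \<beta> \<circ> \<alpha>"
    and \<alpha>_mult: "\<lbrakk>x \<in> V g; y \<in> V h\<rbrakk> \<Longrightarrow> \<alpha> (x \<cdot> y) = \<alpha> x \<cdot> \<alpha> y"
    and \<beta>_mult: "\<lbrakk>x \<in> V g; y \<in> V h\<rbrakk> \<Longrightarrow> \<beta> (x \<cdot> y) = \<beta> x \<cdot> \<beta> y"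
    and bihom_assoc: "\<lbrakk>x \<in> V g; y \<in> V h; z \<in> V k\<rbrakk> \<Longrightarrow> \<alpha> x \<cdot> (y \<cdot> z) = (x \<cdot> y) \<cdot> \<beta> z"

locale regular_bihom_assoc_color_algebra = bihom_assoc_color_algebra +
  assumes bij_\<alpha>: "bij \<alpha>" and bij_\<beta>: "bij \<beta>"

locale bihom_poisson_color_algebra =
  bihom_assoc_color_algebra scale V \<epsilon> mult \<alpha> \<beta>
  for scale :: "'k::field \<Rightarrow> 'a::ab_group_add \<Rightarrow> 'a"  (infixr \<open>*s\<close> 75)
    and V :: "'g::ab_group_add \<Rightarrow> 'a set"
    and \<epsilon> :: "'g \<Rightarrow> 'g \<Rightarrow> 'k"
    and mult :: "'a \<Rightarrow> 'a \<Rightarrow> 'a"  (infixl \<open>\<cdot>\<close> 70)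
    and \<alpha> \<beta> :: "'a \<Rightarrow> 'a" +
  fixes br :: "'a \<Rightarrow> 'a \<Rightarrow> 'a"
  assumes br_even_bilinear: "even_bilinear scale V br"
    and \<alpha>_br: "\<lbrakk>x \<in> V g; y \<in> V h\<rbrakk> \<Longrightarrow> \<alpha> (br x y) = br (\<alpha> x) (\<alpha> y)"
    and \<beta>_br: "\<lbrakk>x \<in> V g; y \<in> V h\<rbrakk> \<Longrightarrow> \<beta> (br x y) = br (\<beta> x) (\<beta> y)"
    and bihom_skew: "\<lbrakk>x \<in> V g; y \<in> V h\<rbrakk> \<Longrightarrow>
      br (\<beta> x) (\<alpha> y) = - (\<epsilon> g h *s br (\<beta> y) (\<alpha> x))"
    and bihom_jacobi: "\<lbrakk>x \<in> V g; y \<in> V h; z \<in> V k\<rbrakk> \<Longrightarrow>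
      \<epsilon> k g *s br (\<beta> (\<beta> x)) (br (\<beta> y) (\<alpha> z))
      + \<epsilon> g h *s br (\<beta> (\<beta> y)) (br (\<beta> z) (\<alpha> x))
      + \<epsilon> h k *s br (\<beta> (\<beta> z)) (br (\<beta> x) (\<alpha> y)) = 0"
    and bihom_leibniz: "\<lbrakk>x \<in> V g; y \<in> V h; z \<in> V k\<rbrakk> \<Longrightarrow>
      br (\<alpha> (\<beta> x)) (y \<cdot> z) = br (\<beta> x) y \<cdot> \<beta> z + \<epsilon> g h *s (\<beta> y \<cdot> br (\<alpha> x) z)"

locale regular_bihom_poisson_color_algebra = bihom_poisson_color_algebra +
  assumes bij_\<alpha>: "bij \<alpha>" and bij_\<beta>: "bij \<beta>"

(* br is an even bilinear map given on homogeneous elements by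
   [x, y] = x y - epsilon (x, y) (alpha^-1 beta y) (alpha beta^-1 x).
   Meaningful only for bijective alpha, beta. *)
definition is_bihom_color_commutator ::
    "('k::field \<Rightarrow> 'a::ab_group_add \<Rightarrow> 'a) \<Rightarrow> ('g::ab_group_add \<Rightarrow> 'a set) \<Rightarrow> ('g \<Rightarrow> 'g \<Rightarrow> 'k) \<Rightarrow>
     ('a \<Rightarrow> 'a \<Rightarrow> 'a) \<Rightarrow> ('a \<Rightarrow> 'a) \<Rightarrow> ('a \<Rightarrow> 'a) \<Rightarrow> ('a \<Rightarrow> 'a \<Rightarrow> 'a) \<Rightarrow> bool"
  where "is_bihom_color_commutator scale V \<epsilon> mult \<alpha> \<beta> br \<longleftrightarrow>
    even_bilinear scale V br \<and>
    (\<forall>g h. \<forall>x\<in>V g. \<forall>y\<in>V h.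
      br x y = mult x y - scale (\<epsilon> g h) (mult (inv \<alpha> (\<beta> y)) (\<alpha> (inv \<beta> x))))"

end

theory Submission
  imports Defs
begin

text \<open>
  On homogeneous elements all axioms are short computations. Writing \<open>T x y z\<close> for the \<open>triple\<close>
  product \<open>\<beta>\<^sup>2 x \<cdot> (\<beta> y \<cdot> \<alpha> z)\<close>, twisted associativity turns both halves of a nested commutator
  into the same shape: \<open>(\<alpha>\<inverse> \<beta>\<^sup>2 y \<cdot> \<beta> z) \<cdot> \<alpha> \<beta> x = T y z x\<close>. The bracket
  \<open>[\<beta>\<^sup>2 x, [\<beta> y, \<alpha> z]]\<close> therefore is a combination of four values of \<open>T\<close>, exactly as for an
  ordinary associative algebra, and after multiplication by \<open>\<epsilon>(z, x)\<close> the cyclic sum cancels in pairs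
  (\<open>commutator_jacobi\<close>). In the Leibniz rule (\<open>commutator_leibniz\<close>) twisted
  associativity matches the two terms on the left with the outer terms on the right, and the two
  inner terms on the right cancel, as in the usual \<open>[x, y z] = [x, y] z + y [x, z]\<close>.

  Since \<open>\<epsilon>\<close> depends on degrees, the defining formula only makes sense for homogeneous arguments, so
  the existence of the bracket on the whole space needs the grading: a family of linear maps, one
  for each degree, glues to a linear map (\<open>linear_glue\<close>), and doing this in each argument
  gives a bilinear map. Uniqueness is the statement that a linear map is determined
  by its values on homogeneous elements (\<open>linear_eq_on_homogeneous\<close>). For the
  bracket to be even, the inverses of \<open>\<alpha>\<close> and \<open>\<beta>\<close> must preserve degrees, which holds because a
  bijective even map carries decompositions to decompositions (\<open>inv_even\<close>).
\<close>

section \<open>Linear maps on a graded vector space\<close>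

context graded_vector_space
begin

definition component :: "'a \<Rightarrow> 'g \<Rightarrow> 'a"
  where "component x = (THE f. (\<forall>g. f g \<in> V g) \<and> finite {g. f g \<noteq> 0} \<and> x = (\<Sum>g | f g \<noteq> 0. f g))"

abbreviation supp :: "'a \<Rightarrow> 'g set"
  where "supp x \<equiv> {g. component x g \<noteq> 0}"

lemma comp_in: "component x g \<in> V g"
  and finite_supp: "finite (supp x)"
  and sum_comp: "x = (\<Sum>g\<in>supp x. component x g)"
  using theI'[OF unique_decomposition[of x]] unfolding component_def by blast+

text \<open>The index set may be larger than the support, so that the components of several vectors can be
  compared over a common index set.\<close>

lemma comp_unique:
  assumes "\<And>g. f g \<in> V g" "finite S" "\<And>g. g \<notin> S \<Longrightarrow> f g = 0" "x = sum f S"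
  shows "component x = f"
proof -
  have sub: "{g. f g \<noteq> 0} \<subseteq> S" using assms(3) by blast
  then have "x = (\<Sum>g | f g \<noteq> 0. f g)"
    using assms(2,4) by (auto intro!: sum.mono_neutral_right)
  then show ?thesis
    using unique_decomposition[of x] assms(1) finite_subset[OF sub assms(2)]
      comp_in finite_supp sum_comp by blast
qed

lemma sum_comp_superset:
  assumes "finite S" "supp x \<subseteq> S"
  shows "x = (\<Sum>g\<in>S. component x g)"
proof -
  have "(\<Sum>g\<in>supp x. component x g) = (\<Sum>g\<in>S. component x g)"
    using assms by (intro sum.mono_neutral_left) auto
  with sum_comp[of x] show ?thesis by simp
qed

lemma comp_homogeneous:
  assumes "x \<in> V g"
  shows "component x = (\<lambda>h. if h = g then x else 0)"
  using assms subspace_0[OF subspace_component] by (intro comp_unique[of _ "{g}"]) auto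

lemma comp_add: "component (x + y) = (\<lambda>g. component x g + component y g)"
proof (rule comp_unique[where S = "supp x \<union> supp y"])
  have "x = (\<Sum>g\<in>supp x \<union> supp y. component x g)" "y = (\<Sum>g\<in>supp x \<union> supp y. component y g)"
    using finite_supp by (intro sum_comp_superset; blast)+
  then show "x + y = (\<Sum>g\<in>supp x \<union> supp y. component x g + component y g)"
    by (simp add: sum.distrib)
qed (use finite_supp comp_in subspace_add[OF subspace_component] in auto)

lemma comp_scale: "component (c *s x) = (\<lambda>g. c *s component x g)"
proof (rule comp_unique[where S = "supp x"])
  show "c *s x = (\<Sum>g\<in>supp x. c *s component x g)"
    using sum_comp[of x] by (simp flip: scale_sum_right)
qed (use finite_supp comp_in subspace_scale[OF subspace_component] in auto)

lemma linearI:
  assumes "\<And>x y. f (x + y) = f x + f y" "\<And>c x. f (c *s x) = c *s f x"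
  shows "Vector_Spaces.linear scale scale f"
  using assms by (simp add: Vector_Spaces.linear_iff vector_space_axioms)

lemma linear_rules:
  assumes "Vector_Spaces.linear scale scale f"
  shows "f (x + y) = f x + f y" "f (x - y) = f x - f y" "f (c *s x) = c *s f x"
proof -
  interpret f: Vector_Spaces.linear scale scale f by fact
  show "f (x + y) = f x + f y" "f (x - y) = f x - f y" "f (c *s x) = c *s f x"
    by (simp_all add: f.add f.diff f.scale)
qed

lemma linear_finite_sum:
  assumes "\<And>i. i \<in> S \<Longrightarrow> Vector_Spaces.linear scale scale (F i)"
  shows "Vector_Spaces.linear scale scale (\<lambda>x. \<Sum>i\<in>S. F i x)"
  using assms
  by (intro linearI)
    (auto simp: Vector_Spaces.linear_iff sum.distrib scale_sum_right intro: sum.cong)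

lemma linear_sum:
  assumes "Vector_Spaces.linear scale scale f"
  shows "f (\<Sum>i\<in>S. x i) = (\<Sum>i\<in>S. f (x i))"
proof -
  interpret f: Vector_Spaces.linear scale scale f by fact
  show ?thesis by (rule f.sum)
qed

lemma linear_inv:
  assumes "Vector_Spaces.linear scale scale f" "bij f"
  shows "Vector_Spaces.linear scale scale (inv f)"
proof -
  interpret f: Vector_Spaces.linear scale scale f by fact
  have inj: "inj f" and cancel: "f (inv f x) = x" for x
    using assms(2) by (simp_all add: bij_is_inj bij_is_surj surj_f_inv_f)
  show ?thesis
    by (intro linearI inv_f_eq[OF inj]) (simp_all add: f.add f.scale cancel)
qed

lemma linear_eq_on_homogeneous:
  assumes "Vector_Spaces.linear scale scale f" "Vector_Spaces.linear scale scale f'"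
    and "\<And>g x. x \<in> V g \<Longrightarrow> f x = f' x"
  shows "f = f'"
proof
  fix x
  have "(\<Sum>g\<in>supp x. f (component x g)) = (\<Sum>g\<in>supp x. f' (component x g))"
    using assms(3)[OF comp_in] by simp
  then show "f x = f' x"
    using linear_sum[OF assms(1)] linear_sum[OF assms(2)] sum_comp[of x] by metis
qed

definition glue :: "('g \<Rightarrow> 'a \<Rightarrow> 'a) \<Rightarrow> 'a \<Rightarrow> 'a"
  where "glue F x = (\<Sum>g\<in>supp x. F g (component x g))"

lemma linear_glue:
  assumes "\<And>g. Vector_Spaces.linear scale scale (F g)"
  shows "Vector_Spaces.linear scale scale (glue F)"
proof (rule linearI)
  have F: "F g (x + y) = F g x + F g y" "F g (c *s x) = c *s F g x" "F g 0 = 0" for g x y c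
    using assms[of g] by (auto simp: Vector_Spaces.linear_iff)
      (metis scale_zero_left)
  have glue_superset: "glue F x = (\<Sum>g\<in>S. F g (component x g))" if "finite S" "supp x \<subseteq> S" for x S
    unfolding glue_def using that by (intro sum.mono_neutral_left) (auto simp: F)
  fix x y :: 'a and c :: 'k
  let ?S = "supp x \<union> supp y"
  have fin: "finite ?S" using finite_supp by simp
  have "glue F (x + y) = (\<Sum>g\<in>?S. F g (component (x + y) g))"
    by (rule glue_superset[OF fin]) (auto simp: comp_add)
  also have "\<dots> = (\<Sum>g\<in>?S. F g (component x g)) + (\<Sum>g\<in>?S. F g (component y g))"
    by (simp add: comp_add F sum.distrib)
  also have "\<dots> = glue F x + glue F y"
    using glue_superset[OF fin, of x] glue_superset[OF fin, of y] by simp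
  finally show "glue F (x + y) = glue F x + glue F y" .
  have "glue F (c *s x) = (\<Sum>g\<in>supp x. F g (component (c *s x) g))"
    by (rule glue_superset[OF finite_supp]) (auto simp: comp_scale)
  then show "glue F (c *s x) = c *s glue F x"
    by (simp add: comp_scale F glue_def scale_sum_right)
qed

lemma glue_homogeneous:
  assumes "x \<in> V g" "F g 0 = 0"
  shows "glue F x = F g x"
  using assms by (cases "x = 0") (simp_all add: glue_def comp_homogeneous)

text \<open>Decompose the preimage \<open>inv f x\<close> and apply \<open>f\<close> to its components: the result is the decomposition
  of \<open>x\<close>, which has a single component, and injectivity transports this back.\<close>

lemma inv_even:
  assumes "even_linear scale V f" "bij f" "x \<in> V g"
  shows "inv f x \<in> V g"
proof -
  have lin: "Vector_Spaces.linear scale scale f" and even: "\<And>h y. y \<in> V h \<Longrightarrow> f y \<in> V h"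
    using assms(1) by (auto simp: even_linear_def)
  have f0: "f 0 = 0"
    using lin by (metis Vector_Spaces.linear_iff scale_zero_left)
  define y where "y = inv f x"
  have fy: "f y = x" using assms(2) by (simp add: y_def bij_is_surj surj_f_inv_f)
  have "component x = (\<lambda>h. f (component y h))"
  proof (rule comp_unique[where S = "supp y"])
    show "x = (\<Sum>h\<in>supp y. f (component y h))"
      using linear_sum[OF lin, of "component y" "supp y"] sum_comp[of y] fy by simp
  qed (auto simp: finite_supp f0 intro: even comp_in)
  then have "f (component y h) = f 0" if "h \<noteq> g" for h
    using comp_homogeneous[OF assms(3)] that f0 by metis
  then have "component y h = 0" if "h \<noteq> g" for h
    using that assms(2) by (metis bij_is_inj injD)
  then have "supp y \<subseteq> {g}" by blast
  then have "y = (\<Sum>h\<in>{g}. component y h)"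
    by (intro sum_comp_superset) auto
  then show ?thesis using comp_in[of y g] by (simp add: y_def)
qed

end

lemma even_bilinear_eq_on_homogeneous:
  assumes "graded_vector_space scale V"
    and "even_bilinear scale V m" "even_bilinear scale V m'"
    and "\<And>g h x y. \<lbrakk>x \<in> V g; y \<in> V h\<rbrakk> \<Longrightarrow> m x y = m' x y"
  shows "m = m'"
proof -
  interpret graded_vector_space scale V by fact
  have "(\<lambda>x. m x y) = (\<lambda>x. m' x y)" if y: "y \<in> V h" for y h
    using assms(2-4) y by (intro linear_eq_on_homogeneous) (auto simp: even_bilinear_def)
  then have "m x = m' x" for x
    using assms(2,3) by (intro linear_eq_on_homogeneous) (auto simp: even_bilinear_def dest: fun_cong)
  then show ?thesis by blast
qed

section \<open>The commutator bracket\<close>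

context regular_bihom_assoc_color_algebra
begin

lemma \<alpha>_linear: "Vector_Spaces.linear scale scale \<alpha>"
  and \<beta>_linear: "Vector_Spaces.linear scale scale \<beta>"
  and \<alpha>_even: "x \<in> V g \<Longrightarrow> \<alpha> x \<in> V g"
  and \<beta>_even: "x \<in> V g \<Longrightarrow> \<beta> x \<in> V g"
  using \<alpha>_even_linear \<beta>_even_linear by (auto simp: even_linear_def)

lemma mult_linear_right: "Vector_Spaces.linear scale scale (\<lambda>y. x \<cdot> y)"
  and mult_linear_left: "Vector_Spaces.linear scale scale (\<lambda>x. x \<cdot> y)"
  and mult_even: "\<lbrakk>x \<in> V g; y \<in> V h\<rbrakk> \<Longrightarrow> x \<cdot> y \<in> V (g + h)"
  using mult_even_bilinear by (auto simp: even_bilinear_def)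

lemma inv_cancel [simp]:
  "\<alpha> (inv \<alpha> x) = x" "inv \<alpha> (\<alpha> x) = x" "\<beta> (inv \<beta> x) = x" "inv \<beta> (\<beta> x) = x"
  using bij_\<alpha> bij_\<beta> by (simp_all add: bij_is_surj surj_f_inv_f bij_is_inj)

lemma inv_\<alpha>_even: "x \<in> V g \<Longrightarrow> inv \<alpha> x \<in> V g"
  and inv_\<beta>_even: "x \<in> V g \<Longrightarrow> inv \<beta> x \<in> V g"
  using inv_even \<alpha>_even_linear \<beta>_even_linear bij_\<alpha> bij_\<beta> by blast+

lemmas evens = \<alpha>_even \<beta>_even inv_\<alpha>_even inv_\<beta>_even

text \<open>Oriented so that rewriting moves powers of \<open>\<alpha>\<close> inwards and brings inverse maps
  next to each other.\<close>

lemma twist_commute: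
  "\<alpha> (\<beta> x) = \<beta> (\<alpha> x)" "inv \<alpha> (\<beta> x) = \<beta> (inv \<alpha> x)" "\<alpha> (inv \<beta> x) = inv \<beta> (\<alpha> x)"
proof -
  show comm: "\<alpha> (\<beta> x) = \<beta> (\<alpha> x)" for x using \<alpha>_\<beta>_commute by (metis comp_apply)
  show "inv \<alpha> (\<beta> x) = \<beta> (inv \<alpha> x)" by (metis comm inv_cancel)
  show "\<alpha> (inv \<beta> x) = inv \<beta> (\<alpha> x)" by (metis comm inv_cancel)
qed

lemma inv_\<alpha>_mult: "\<lbrakk>x \<in> V g; y \<in> V h\<rbrakk> \<Longrightarrow> inv \<alpha> (x \<cdot> y) = inv \<alpha> x \<cdot> inv \<alpha> y"
  using \<alpha>_mult[OF inv_\<alpha>_even inv_\<alpha>_even, of x g y h] bij_\<alpha>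
  by (intro inv_f_eq) (simp_all add: bij_is_inj)

lemma inv_\<alpha>_linear: "Vector_Spaces.linear scale scale (inv \<alpha>)"
  and inv_\<beta>_linear: "Vector_Spaces.linear scale scale (inv \<beta>)"
  using linear_inv \<alpha>_linear \<beta>_linear bij_\<alpha> bij_\<beta> by blast+

lemmas linear_simps =
  linear_rules[OF \<alpha>_linear] linear_rules[OF \<beta>_linear]
  linear_rules[OF inv_\<alpha>_linear] linear_rules[OF inv_\<beta>_linear]
  linear_rules[OF mult_linear_right] linear_rules[OF mult_linear_left]

text \<open>For fixed degrees the defining formula is bilinear on the whole space; gluing these bilinear
  maps over the degrees of both arguments gives the bracket.\<close>

lemma ex_commutator: "\<exists>br. is_bihom_color_commutator scale V \<epsilon> mult \<alpha> \<beta> br"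
proof -
  define F where "F g h x y = x \<cdot> y - \<epsilon> g h *s (inv \<alpha> (\<beta> y) \<cdot> \<alpha> (inv \<beta> x))" for g h x y
  have F_linear: "Vector_Spaces.linear scale scale (\<lambda>y. F g h x y)"
    "Vector_Spaces.linear scale scale (\<lambda>x. F g h x y)" for g h x y
    by (rule linearI; simp add: F_def linear_simps scale_right_distrib scale_right_diff_distrib mult.commute)+
  define br where "br x y = glue (\<lambda>g u. glue (\<lambda>h. F g h u) y) x" for x y
  have inner: "Vector_Spaces.linear scale scale (\<lambda>u. glue (\<lambda>h. F g h u) y)" for g y
    unfolding glue_def by (intro linear_finite_sum F_linear)
  have zero: "f 0 = 0" if "Vector_Spaces.linear scale scale f" for f
    using that by (metis Vector_Spaces.linear_iff scale_zero_left)
  have br_hom: "br x y = F g h x y" if "x \<in> V g" "y \<in> V h" for x y g h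
    unfolding br_def using that zero[OF inner] zero[OF F_linear(1)]
    by (subst glue_homogeneous; simp add: glue_homogeneous)
  have "Vector_Spaces.linear scale scale (\<lambda>y. br x y)" for x
    unfolding br_def glue_def[of _ x] by (intro linear_finite_sum linear_glue F_linear)
  moreover have "Vector_Spaces.linear scale scale (\<lambda>x. br x y)" for y
    unfolding br_def by (intro linear_glue inner)
  moreover have "br x y \<in> V (g + h)" if x: "x \<in> V g" and y: "y \<in> V h" for x y g h
  proof -
    have "inv \<alpha> (\<beta> y) \<cdot> \<alpha> (inv \<beta> x) \<in> V (g + h)"
      using mult_even[of "inv \<alpha> (\<beta> y)" h "\<alpha> (inv \<beta> x)" g] x y by (simp add: evens add.commute)
    then show ?thesis
      unfolding br_hom[OF x y] F_def using mult_even[OF x y]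
      by (intro subspace_diff subspace_scale subspace_component)
  qed
  ultimately show ?thesis
    using br_hom unfolding is_bihom_color_commutator_def even_bilinear_def F_def by blast
qed

end

section \<open>The identities of a BiHom-Poisson color algebra\<close>

locale bihom_color_commutator = regular_bihom_assoc_color_algebra +
  fixes br :: "'b \<Rightarrow> 'b \<Rightarrow> 'b"
  assumes commutator: "is_bihom_color_commutator scale V \<epsilon> mult \<alpha> \<beta> br"
begin

lemma br_hom:
  "\<lbrakk>x \<in> V g; y \<in> V h\<rbrakk> \<Longrightarrow> br x y = x \<cdot> y - \<epsilon> g h *s (inv \<alpha> (\<beta> y) \<cdot> \<alpha> (inv \<beta> x))"
  using commutator unfolding is_bihom_color_commutator_def by blast

lemma br_even_bilinear: "even_bilinear scale V br"
  using commutator unfolding is_bihom_color_commutator_def by blast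

lemma br_even: "\<lbrakk>x \<in> V g; y \<in> V h\<rbrakk> \<Longrightarrow> br x y \<in> V (g + h)"
  using br_even_bilinear unfolding even_bilinear_def by blast

lemma \<alpha>_commutator:
  assumes "x \<in> V g" "y \<in> V h"
  shows "\<alpha> (br x y) = br (\<alpha> x) (\<alpha> y)"
proof -
  have "\<alpha> (inv \<alpha> (\<beta> y) \<cdot> \<alpha> (inv \<beta> x)) = inv \<alpha> (\<beta> (\<alpha> y)) \<cdot> \<alpha> (inv \<beta> (\<alpha> x))"
    using assms \<alpha>_mult[of "inv \<alpha> (\<beta> y)" h "\<alpha> (inv \<beta> x)" g] by (simp add: evens twist_commute)
  then show ?thesis
    using assms by (simp add: br_hom[of _ g _ h] evens linear_simps \<alpha>_mult)
qed

lemma \<beta>_commutator: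
  assumes "x \<in> V g" "y \<in> V h"
  shows "\<beta> (br x y) = br (\<beta> x) (\<beta> y)"
proof -
  have "\<beta> (inv \<alpha> (\<beta> y) \<cdot> \<alpha> (inv \<beta> x)) = inv \<alpha> (\<beta> (\<beta> y)) \<cdot> \<alpha> (inv \<beta> (\<beta> x))"
    using assms \<beta>_mult[of "inv \<alpha> (\<beta> y)" h "\<alpha> (inv \<beta> x)" g] by (simp add: evens twist_commute)
  then show ?thesis
    using assms by (simp add: br_hom[of _ g _ h] evens linear_simps \<beta>_mult)
qed

text \<open>The twists of the Jacobi identity are placed so that the inverse maps in the bracket cancel. What
  remains is an ordinary color commutator for the product \<open>(x, y) \<mapsto> \<beta> x \<cdot> \<alpha> y\<close>.\<close>

lemma commutator_\<beta>_\<alpha>: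
  assumes "x \<in> V g" "y \<in> V h"
  shows "br (\<beta> x) (\<alpha> y) = \<beta> x \<cdot> \<alpha> y - \<epsilon> g h *s (\<beta> y \<cdot> \<alpha> x)"
  using assms by (simp add: br_hom[of _ g _ h] evens twist_commute)

lemma commutator_skew:
  assumes "x \<in> V g" "y \<in> V h"
  shows "br (\<beta> x) (\<alpha> y) = - (\<epsilon> g h *s br (\<beta> y) (\<alpha> x))"
  using assms
  by (simp add: commutator_\<beta>_\<alpha>[of _ g _ h] commutator_\<beta>_\<alpha>[of _ h _ g] scale_right_diff_distrib skew)

definition triple :: "'b \<Rightarrow> 'b \<Rightarrow> 'b \<Rightarrow> 'b"
  where "triple x y z = \<beta> (\<beta> x) \<cdot> (\<beta> y \<cdot> \<alpha> z)"

text \<open>This identity makes left-nested and right-nested products comparable: twisted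
  associativity puts an \<open>\<alpha>\<close> on the first factor, which the \<open>\<alpha>\<inverse>\<close> of the bracket absorbs.\<close>

lemma triple_reassoc:
  assumes "x \<in> V g" "y \<in> V h" "z \<in> V k"
  shows "inv \<alpha> (\<beta> (\<beta> x \<cdot> \<alpha> y)) \<cdot> \<alpha> (\<beta> z) = triple x y z"
proof -
  have "inv \<alpha> (\<beta> (\<beta> x \<cdot> \<alpha> y)) = inv \<alpha> (\<beta> (\<beta> x)) \<cdot> \<beta> y"
    using assms
    by (simp add: \<beta>_mult[of _ g _ h] inv_\<alpha>_mult[of _ g _ h] evens flip: twist_commute(1))
  then have "inv \<alpha> (\<beta> (\<beta> x \<cdot> \<alpha> y)) \<cdot> \<alpha> (\<beta> z) = (inv \<alpha> (\<beta> (\<beta> x)) \<cdot> \<beta> y) \<cdot> \<beta> (\<alpha> z)"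
    by (simp add: twist_commute(1))
  also have "\<dots> = \<alpha> (inv \<alpha> (\<beta> (\<beta> x))) \<cdot> (\<beta> y \<cdot> \<alpha> z)"
    using assms by (intro bihom_assoc[symmetric] evens)
  finally show ?thesis by (simp add: triple_def)
qed

lemma nested_commutator:
  assumes x: "x \<in> V g" and y: "y \<in> V h" and z: "z \<in> V k"
  shows "br (\<beta> (\<beta> x)) (br (\<beta> y) (\<alpha> z)) =
    triple x y z - \<epsilon> h k *s triple x z y
    - (\<epsilon> g h * \<epsilon> g k) *s triple y z x + (\<epsilon> g h * \<epsilon> g k * \<epsilon> h k) *s triple z y x"
proof -
  let ?b = "br (\<beta> y) (\<alpha> z)"
  have b: "?b = \<beta> y \<cdot> \<alpha> z - \<epsilon> h k *s (\<beta> z \<cdot> \<alpha> y)"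
    by (rule commutator_\<beta>_\<alpha>[OF y z])
  have "?b \<in> V (h + k)" using y z by (intro br_even evens)
  then have "br (\<beta> (\<beta> x)) ?b
      = \<beta> (\<beta> x) \<cdot> ?b - \<epsilon> g (h + k) *s (inv \<alpha> (\<beta> ?b) \<cdot> \<alpha> (inv \<beta> (\<beta> (\<beta> x))))"
    using x by (intro br_hom evens)
  also have "\<beta> (\<beta> x) \<cdot> ?b = triple x y z - \<epsilon> h k *s triple x z y"
    by (simp add: b linear_simps triple_def)
  also have "inv \<alpha> (\<beta> ?b) \<cdot> \<alpha> (inv \<beta> (\<beta> (\<beta> x))) = triple y z x - \<epsilon> h k *s triple z y x"
    by (simp add: b linear_simps triple_reassoc[OF y z x] triple_reassoc[OF z y x])
  finally show ?thesis
    by (simp add: add_right scale_right_diff_distrib)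
qed

text \<open>The factor \<open>\<epsilon> k g\<close> makes the coefficients cyclically compatible: the third and fourth terms
  are now the first and second after a cyclic shift of the variables, with opposite signs.\<close>

lemma scaled_nested_commutator:
  assumes "x \<in> V g" "y \<in> V h" "z \<in> V k"
  shows "\<epsilon> k g *s br (\<beta> (\<beta> x)) (br (\<beta> y) (\<alpha> z)) =
    \<epsilon> k g *s triple x y z - (\<epsilon> k g * \<epsilon> h k) *s triple x z y
    - \<epsilon> g h *s triple y z x + (\<epsilon> g h * \<epsilon> h k) *s triple z y x"
proof -
  have "\<epsilon> k g * (\<epsilon> g h * \<epsilon> g k) = \<epsilon> g h"
    using skew[of k g] by (simp add: mult.left_commute)
  moreover from this have "\<epsilon> k g * (\<epsilon> g h * \<epsilon> g k * \<epsilon> h k) = \<epsilon> g h * \<epsilon> h k"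
    by (metis mult.assoc)
  ultimately show ?thesis
    by (simp only: nested_commutator[OF assms] scale_right_diff_distrib scale_right_distrib
        scale_scale)
qed

lemma commutator_jacobi:
  assumes "x \<in> V g" "y \<in> V h" "z \<in> V k"
  shows "\<epsilon> k g *s br (\<beta> (\<beta> x)) (br (\<beta> y) (\<alpha> z))
    + \<epsilon> g h *s br (\<beta> (\<beta> y)) (br (\<beta> z) (\<alpha> x))
    + \<epsilon> h k *s br (\<beta> (\<beta> z)) (br (\<beta> x) (\<alpha> y)) = 0"
  unfolding scaled_nested_commutator[OF assms(1,2,3)] scaled_nested_commutator[OF assms(2,3,1)]
    scaled_nested_commutator[OF assms(3,1,2)]
  by (simp add: mult.commute)

lemma commutator_leibniz:
  assumes x: "x \<in> V g" and y: "y \<in> V h" and z: "z \<in> V k"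
  shows "br (\<alpha> (\<beta> x)) (y \<cdot> z) = br (\<beta> x) y \<cdot> \<beta> z + \<epsilon> g h *s (\<beta> y \<cdot> br (\<alpha> x) z)"
proof -
  let ?y = "inv \<alpha> (\<beta> y)" and ?z = "inv \<alpha> (\<beta> z)"
  have "br (\<alpha> (\<beta> x)) (y \<cdot> z)
      = \<alpha> (\<beta> x) \<cdot> (y \<cdot> z) - \<epsilon> g (h + k) *s (inv \<alpha> (\<beta> (y \<cdot> z)) \<cdot> \<alpha> (inv \<beta> (\<alpha> (\<beta> x))))"
    using x y z by (intro br_hom mult_even evens)
  also have "inv \<alpha> (\<beta> (y \<cdot> z)) = ?y \<cdot> ?z"
    using y z by (simp add: \<beta>_mult[of _ h _ k] inv_\<alpha>_mult[of _ h _ k] evens)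
  also have "\<alpha> (inv \<beta> (\<alpha> (\<beta> x))) = \<beta> (\<alpha> (inv \<beta> (\<alpha> x)))"
    by (simp add: twist_commute)
  also have "(?y \<cdot> ?z) \<cdot> \<beta> (\<alpha> (inv \<beta> (\<alpha> x))) = \<beta> y \<cdot> (?z \<cdot> \<alpha> (inv \<beta> (\<alpha> x)))"
    using bihom_assoc[of ?y h ?z k "\<alpha> (inv \<beta> (\<alpha> x))" g] x y z by (simp add: evens)
  finally have lhs: "br (\<alpha> (\<beta> x)) (y \<cdot> z)
      = \<alpha> (\<beta> x) \<cdot> (y \<cdot> z) - (\<epsilon> g h * \<epsilon> g k) *s (\<beta> y \<cdot> (?z \<cdot> \<alpha> (inv \<beta> (\<alpha> x))))"
    by (simp add: add_right)
  have "br (\<beta> x) y = \<beta> x \<cdot> y - \<epsilon> g h *s (?y \<cdot> \<alpha> x)"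
    using x y by (simp add: br_hom[of _ g _ h] evens)
  then have left: "br (\<beta> x) y \<cdot> \<beta> z = \<alpha> (\<beta> x) \<cdot> (y \<cdot> z) - \<epsilon> g h *s (?y \<cdot> \<alpha> x \<cdot> \<beta> z)"
    using bihom_assoc[of "\<beta> x" g y h z k] x y z by (simp add: evens linear_simps)
  have "br (\<alpha> x) z = \<alpha> x \<cdot> z - \<epsilon> g k *s (?z \<cdot> \<alpha> (inv \<beta> (\<alpha> x)))"
    using x z by (simp add: br_hom[of _ g _ k] evens)
  then have right: "\<beta> y \<cdot> br (\<alpha> x) z
      = ?y \<cdot> \<alpha> x \<cdot> \<beta> z - \<epsilon> g k *s (\<beta> y \<cdot> (?z \<cdot> \<alpha> (inv \<beta> (\<alpha> x))))"
    using bihom_assoc[of ?y h "\<alpha> x" g z k] x y z by (simp add: evens linear_simps)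
  \<comment> \<open>The inner product \<open>?y \<cdot> \<alpha> x \<cdot> \<beta> z\<close> occurs in both summands with opposite signs.\<close>
  show ?thesis
    unfolding lhs left right by (simp add: scale_right_diff_distrib)
qed

lemma regular_poisson: "regular_bihom_poisson_color_algebra scale V \<epsilon> mult \<alpha> \<beta> br"
  by unfold_locales
    (fact br_even_bilinear \<alpha>_commutator \<beta>_commutator commutator_skew commutator_jacobi
      commutator_leibniz bij_\<alpha> bij_\<beta>)+

end

theorem theorem2p13:
  fixes scale :: "'k::field \<Rightarrow> 'a::ab_group_add \<Rightarrow> 'a"
    and A :: "'g::ab_group_add \<Rightarrow> 'a set"
    and \<epsilon> :: "'g \<Rightarrow> 'g \<Rightarrow> 'k"
    and mult :: "'a \<Rightarrow> 'a \<Rightarrow> 'a"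
    and \<alpha> \<beta> :: "'a \<Rightarrow> 'a"
  assumes "CHAR('k) \<noteq> 2"
    and "regular_bihom_assoc_color_algebra scale A \<epsilon> mult \<alpha> \<beta>"
  shows "(\<exists>!br. is_bihom_color_commutator scale A \<epsilon> mult \<alpha> \<beta> br) \<and>
    (\<forall>br. is_bihom_color_commutator scale A \<epsilon> mult \<alpha> \<beta> br \<longrightarrow>
      regular_bihom_poisson_color_algebra scale A \<epsilon> mult \<alpha> \<beta> br)"
proof -
  interpret regular_bihom_assoc_color_algebra scale A \<epsilon> mult \<alpha> \<beta> by fact
  have "br = br'"
    if "is_bihom_color_commutator scale A \<epsilon> mult \<alpha> \<beta> br"
      "is_bihom_color_commutator scale A \<epsilon> mult \<alpha> \<beta> br'" for br br'
    using that unfolding is_bihom_color_commutator_def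
    by (intro even_bilinear_eq_on_homogeneous[OF graded_vector_space_axioms]) auto
  moreover have "regular_bihom_poisson_color_algebra scale A \<epsilon> mult \<alpha> \<beta> br"
    if "is_bihom_color_commutator scale A \<epsilon> mult \<alpha> \<beta> br" for br
  proof -
    interpret bihom_color_commutator scale A \<epsilon> mult \<alpha> \<beta> br
      by unfold_locales (fact that)
    show ?thesis by (rule regular_poisson)
  qed
  ultimately show ?thesis using ex_commutator by blast
qed

end
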